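(* For any $n \in \mathbb{N}$, there is a connected Cayley digraph $\overrightarrow{\mathrm{Cay}}(G;a,b)$, where $G$ is a finite group and $a,b\in G$, such that (1) $\overrightarrow{\mathrm{Cay}}(G;a,b)$ does not have a hamiltonian path, and (2) $a$ and $b$ both have order greater than $n$. Furthermore, if $p$ is any prime number such that $p > 3$ and $p \equiv 3 \pmod{4}$, then (for any $n$) the example may be constructed so that, in addition to (1) and (2), the commutator subgroup $[G,G]$ has order $p$; more precisely, $G = \mathbb{Z}_m \ltimes \mathbb{Z}_p$ is a semidirect product of two cyclic groups (with $\mathbb{Z}_p$ normal, for some positive integer $m$), so $G$ is metacyclic.
   Context: For a subset $S$ of a finite group $G$, the Cayley digraph $\overrightarrow{\mathrm{Cay}}(G;S)$ is the directed graph whose vertices are the elements of $G$, with a directed edge $g \to gs$ for every $g \in G$ and $s \in S$. When $S=\{a,b\}$ we write $\overrightarrow{\mathrm{Cay}}(G;a,b)$. The digraph is connected if and only if $S$ generates $G$. A hamiltonian path is a directed path that visits every vertex exactly once. $\mathbb{Z}_m$ denotes the cyclic group of order $m$. *)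

theory Defs
  imports "HOL-Algebra.Algebra" "HOL-Number_Theory.Cong" "Graph_Theory.Graph_Theory"
begin

text \<open>An arc is a pair \<open>(g, s)\<close>, running from \<open>g\<close> to \<open>g s\<close>.\<close>

definition cayley_digraph ::
    "('a, 'b) monoid_scheme \<Rightarrow> 'a set \<Rightarrow> ('a, 'a \<times> 'a) pre_digraph" where
  "cayley_digraph G S =
     \<lparr> verts = carrier G, arcs = carrier G \<times> S,
       tail = fst, head = (\<lambda>(g, s). g \<otimes>\<^bsub>G\<^esub> s) \<rparr>"

definition hamiltonian_path ::
    "('a, 'b) pre_digraph \<Rightarrow> 'a \<Rightarrow> 'b awalk \<Rightarrow> 'a \<Rightarrow> bool" where
  "hamiltonian_path D u p v \<longleftrightarrow>
     pre_digraph.apath D u p v \<and> set (pre_digraph.awalk_verts D u p) = verts D"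

definition has_hamiltonian_path :: "('a, 'b) pre_digraph \<Rightarrow> bool" where
  "has_hamiltonian_path D \<longleftrightarrow> (\<exists>u p v. hamiltonian_path D u p v)"

text \<open>The external semidirect product of \<open>H\<close> and \<open>N\<close>, with \<open>N\<close> normal, for an action
  \<open>\<phi> \<in> hom H (AutoGroup N)\<close>. The pair \<open>(h, x)\<close> stands for the product of \<open>x\<close> and \<open>h\<close>, in
  this order, so that conjugation by \<open>h\<close> acts on \<open>N\<close> as \<open>\<phi> h\<close>.\<close>

definition semidirect_product ::
    "('h, 'c) monoid_scheme \<Rightarrow> ('n, 'd) monoid_scheme \<Rightarrow> ('h \<Rightarrow> 'n \<Rightarrow> 'n) \<Rightarrow> ('h \<times> 'n) monoid"
  where
  "semidirect_product H N \<phi> =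
     \<lparr> carrier = carrier H \<times> carrier N,
       monoid.mult = (\<lambda>(h, x) (k, y). (h \<otimes>\<^bsub>H\<^esub> k, x \<otimes>\<^bsub>N\<^esub> \<phi> h y)),
       one = (\<one>\<^bsub>H\<^esub>, \<one>\<^bsub>N\<^esub>) \<rparr>"

definition metacyclic_group :: "('a, 'b) monoid_scheme \<Rightarrow> bool" where
  "metacyclic_group G \<longleftrightarrow>
     (\<exists>N. N \<lhd> G \<and> cyclic_group (subgroup_generated G N) \<and> cyclic_group (G Mod N))"

lemma group_semidirect_product:
  assumes "group H" "group N" and hom: "\<phi> \<in> hom H (AutoGroup N)"
  shows "group (semidirect_product H N \<phi>)"
proof -
  interpret H: group H by fact
  interpret N: group N by fact
  interpret A: group "AutoGroup N" by (rule N.AutoGroup)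
  interpret \<phi>: group_hom H "AutoGroup N" \<phi>
    using hom by unfold_locales
  have auto: "\<phi> h \<in> hom N N \<and> \<phi> h \<in> carrier N \<rightarrow> carrier N" if "h \<in> carrier H" for h
  proof -
    have "\<phi> h \<in> carrier (AutoGroup N)" using that by simp
    then show ?thesis
      by (auto simp: AutoGroup_def auto_def hom_def)
  qed
  have clo: "\<phi> h x \<in> carrier N" if "h \<in> carrier H" "x \<in> carrier N" for h x
    using auto that by blast
  have mul: "\<phi> h (x \<otimes>\<^bsub>N\<^esub> y) = \<phi> h x \<otimes>\<^bsub>N\<^esub> \<phi> h y"
    if "h \<in> carrier H" "x \<in> carrier N" "y \<in> carrier N" for h x y
    using auto that by (auto simp: hom_def)
  have comp: "\<phi> (h \<otimes>\<^bsub>H\<^esub> k) x = \<phi> h (\<phi> k x)"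
    if "h \<in> carrier H" "k \<in> carrier H" "x \<in> carrier N" for h k x
  proof -
    have "\<phi> h \<in> Bij (carrier N)" "\<phi> k \<in> Bij (carrier N)"
      using \<phi>.hom_closed that by (auto simp: AutoGroup_def auto_def)
    then show ?thesis
      using that \<phi>.hom_mult[of h k] by (simp add: AutoGroup_def BijGroup_def compose_def)
  qed
  have one: "\<phi> \<one>\<^bsub>H\<^esub> x = x" if "x \<in> carrier N" for x
    using that \<phi>.hom_one by (simp add: AutoGroup_def BijGroup_def)
  show ?thesis
  proof (rule groupI)
    fix g assume "g \<in> carrier (semidirect_product H N \<phi>)"
    then obtain h x where g: "g = (h, x)" "h \<in> carrier H" "x \<in> carrier N"
      by (auto simp: semidirect_product_def)
    have "\<phi> (inv\<^bsub>H\<^esub> h) (inv\<^bsub>N\<^esub> x) \<otimes>\<^bsub>N\<^esub> \<phi> (inv\<^bsub>H\<^esub> h) x = \<one>\<^bsub>N\<^esub>"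
      using g mul[of "inv\<^bsub>H\<^esub> h" "inv\<^bsub>N\<^esub> x" x] auto[of "inv\<^bsub>H\<^esub> h"]
        hom_one[of "\<phi> (inv\<^bsub>H\<^esub> h)" N N] by (simp add: N.is_group)
    then show "\<exists>g'\<in>carrier (semidirect_product H N \<phi>).
        g' \<otimes>\<^bsub>semidirect_product H N \<phi>\<^esub> g = \<one>\<^bsub>semidirect_product H N \<phi>\<^esub>"
      using g clo
      by (intro bexI[of _ "(inv\<^bsub>H\<^esub> h, \<phi> (inv\<^bsub>H\<^esub> h) (inv\<^bsub>N\<^esub> x))"])
        (auto simp: semidirect_product_def simp del: \<phi>.hom_inv)
  qed (auto simp: semidirect_product_def H.m_assoc N.m_assoc clo mul comp one
        simp del: \<phi>.hom_mult \<phi>.hom_one)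
qed

end

theory Submission
  imports Defs "HOL-Number_Theory.Residue_Primitive_Roots"
begin

text \<open>
  Let \<open>p = 4 * j + 3\<close> be a prime with \<open>j > 0\<close>, let \<open>g\<close> be a primitive root modulo \<open>p\<close>, and let
  \<open>G\<close> be the semidirect product of \<open>\<int>\<^sub>m\<close> and \<open>\<int>\<^sub>p\<close> in which \<open>k \<in> \<int>\<^sub>m\<close> multiplies \<open>\<int>\<^sub>p\<close> by \<open>g\<^sup>k\<close>,
  where \<open>m = (p - 1) * (n + 1)\<close>. The generators are \<open>a = (2 * j + 1, g)\<close> and \<open>b = (2 * j, 1)\<close>.
  Their orders exceed \<open>n\<close> because those of \<open>2 * j + 1\<close> and \<open>2 * j\<close> in \<open>\<int>\<^sub>m\<close> do.

  There is no hamiltonian path for the following reason. As \<open>a b\<inverse> = (1, 0)\<close>, the vertices \<open>(h, x)\<close>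
  and \<open>(h + 1, x)\<close> satisfy \<open>(h, x) a = (h + 1, x) b\<close>. A path visits this vertex only once, so if
  it leaves \<open>(h, x)\<close> by \<open>a\<close>, then it does not leave \<open>(h + 1, x)\<close> by \<open>b\<close>. Going around the cyclic
  group \<open>\<int>\<^sub>m\<close>, this shows that the path leaves all vertices of the column of \<open>x\<close> by the same
  generator, except perhaps for the column of \<open>x\<^sub>0\<close> that contains the end of the path.

  The generator \<open>a\<close> acts on \<open>\<int>\<^sub>p\<close> by \<open>-1\<close>, so repeated steps along \<open>a\<close> alternate between two
  columns, and every pair of columns is joined by such a cycle. Hence at most one column other
  than that of \<open>x\<^sub>0\<close> is left by \<open>a\<close> (lemma \<open>a_column_unique\<close>), and the others are left by \<open>b\<close>.
  Repeated steps along \<open>b\<close> with \<open>q = g\<^sup>2\<^sup>j\<close> run through columns of the form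
  \<open>c + g\<^sup>h / (q - 1)\<close> with a constant \<open>c\<close>, where the parity of \<open>h\<close> does not change. For \<open>c = x\<^sub>0\<close>
  the two parities of \<open>h\<close> give two disjoint families of columns without \<open>x\<^sub>0\<close>: translates of the
  squares and of the nonsquares modulo \<open>p\<close>, up to a factor. One of them contains no column that
  is left by \<open>a\<close>, and the path would be caught in a cycle there (lemma \<open>a_column_on_circle\<close>).

  The congruence \<open>p \<equiv> 3\<close> modulo \<open>4\<close> makes \<open>(p - 1) / 2 - 1 = 2 * j\<close> even, which is what preserves the
  parity of \<open>h\<close>, and \<open>p > 3\<close> makes \<open>q \<noteq> 1\<close>. The first claim of the theorem is the case
  \<open>p = 7\<close> of the second one.
\<close>

section \<open>Connectedness and hamiltonian paths in Cayley digraphs\<close>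

lemma cayley_digraph_sel [simp]:
  "verts (cayley_digraph G S) = carrier G"
  "arcs (cayley_digraph G S) = carrier G \<times> S"
  "tail (cayley_digraph G S) = fst"
  "head (cayley_digraph G S) = (\<lambda>(g, s). g \<otimes>\<^bsub>G\<^esub> s)"
  by (simp_all add: cayley_digraph_def)

text \<open>Right multiplication by a word in the generators and their inverses is a walk in the
  underlying undirected graph.\<close>

lemma (in group) generate_imp_connected_cayley_digraph:
  assumes S: "S \<subseteq> carrier G" and gen: "generate G S = carrier G"
  shows "Digraph_Component.connected (cayley_digraph G S)"
proof -
  let ?D = "mk_symmetric (cayley_digraph G S)"
  have wf: "wf_digraph (cayley_digraph G S)"
    using S by unfold_locales auto
  interpret D: pair_wf_digraph ?D
    by (rule wf_digraph.wellformed_mk_symmetric[OF wf])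
  have arc: "u \<rightarrow>\<^sup>*\<^bsub>?D\<^esub> (u \<otimes> s)" "(u \<otimes> s) \<rightarrow>\<^sup>*\<^bsub>?D\<^esub> u" if "u \<in> carrier G" "s \<in> S" for u s
  proof -
    have "(u, u \<otimes> s) \<in> parcs ?D" "(u \<otimes> s, u) \<in> parcs ?D"
      using that by (auto simp: parcs_mk_symmetric intro!: bexI[of _ "(u, s)"])
    then show "u \<rightarrow>\<^sup>*\<^bsub>?D\<^esub> (u \<otimes> s)" "(u \<otimes> s) \<rightarrow>\<^sup>*\<^bsub>?D\<^esub> u"
      by (auto intro!: D.reachable_adjI)
  qed
  have reach: "u \<rightarrow>\<^sup>*\<^bsub>?D\<^esub> (u \<otimes> x)" if "x \<in> generate G S" "u \<in> carrier G" for u x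
    using that
  proof (induction arbitrary: u rule: generate.induct)
    case one
    then show ?case by (simp add: D.reachable_refl)
  next
    case (incl s)
    then show ?case by (rule arc(1)[rotated])
  next
    case (inv s)
    then have "s \<in> carrier G" using S by auto
    then show ?case using arc(2)[of "u \<otimes> inv s" s] inv by (simp add: m_assoc)
  next
    case (eng x y)
    then have "x \<in> carrier G" "y \<in> carrier G" using gen by auto
    then show ?case
      using eng.IH(1)[of u] eng.IH(2)[of "u \<otimes> x"] eng.prems
      by (simp add: m_assoc) (rule D.reachable_trans)
  qed
  show ?thesis
    unfolding Digraph_Component.connected_def
  proof (rule strongly_connectedI)
    show "verts (with_proj ?D) \<noteq> {}" by auto
  next
    fix u v assume "u \<in> verts (with_proj ?D)" "v \<in> verts (with_proj ?D)"
    then have uv: "u \<in> carrier G" "v \<in> carrier G" by auto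
    then have "u \<otimes> (inv u \<otimes> v) = v" by (simp flip: m_assoc)
    then show "u \<rightarrow>\<^sup>*\<^bsub>?D\<^esub> v"
      using reach[of "inv u \<otimes> v" u] uv gen by simp
  qed
qed

text \<open>For a hamiltonian path ending at \<open>t\<close>, the map \<open>f\<close> takes every other vertex to the next one
  on the path. Only three properties matter: \<open>f\<close> is injective, it follows arcs, and no nonempty
  set that avoids \<open>t\<close> is closed under \<open>f\<close>, since \<open>f\<close> increases the position along the path.\<close>

lemma hamiltonian_path_successorE:
  assumes "has_hamiltonian_path (cayley_digraph G S)"
  obtains t f where "t \<in> carrier G" "inj_on f (carrier G - {t})"
    "\<And>v. v \<in> carrier G - {t} \<Longrightarrow> \<exists>s\<in>S. f v = v \<otimes>\<^bsub>G\<^esub> s"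
    "\<And>C. C \<subseteq> carrier G - {t} \<Longrightarrow> f ` C \<subseteq> C \<Longrightarrow> C = {}"
proof -
  let ?D = "cayley_digraph G S"
  interpret D: pre_digraph ?D .
  obtain u q v where "hamiltonian_path ?D u q v"
    using assms unfolding has_hamiltonian_path_def by blast
  then have q: "D.cas u q v" "set q \<subseteq> carrier G \<times> S"
    and dist: "distinct (D.awalk_verts u q)" and all: "set (D.awalk_verts u q) = carrier G"
    by (auto simp: hamiltonian_path_def D.apath_def D.awalk_def)
  define xs where "xs = D.awalk_verts u q"
  define l where "l = length q"
  have len: "length xs = Suc l"
    by (simp add: xs_def l_def D.length_awalk_verts)
  have adj: "\<exists>s\<in>S. xs ! Suc i = xs ! i \<otimes>\<^bsub>G\<^esub> s" if "i < l" for i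
  proof -
    have "xs ! i = fst (q ! i)"
      using that unfolding xs_def l_def by (auto simp: D.awalk_verts_conv nth_append)
    moreover have "xs ! Suc i = fst (q ! i) \<otimes>\<^bsub>G\<^esub> snd (q ! i)"
      using that D.awalk_verts_conv'[OF q(1)] unfolding xs_def l_def
      by (auto simp: case_prod_unfold)
    moreover have "snd (q ! i) \<in> S"
      using subsetD[OF q(2) nth_mem[of i q]] that unfolding l_def by (auto simp: mem_Times_iff)
    ultimately show ?thesis by auto
  qed
  define pos where "pos = the_inv_into {..l} ((!) xs)"
  have bij: "bij_betw ((!) xs) {..l} (carrier G)"
    using dist all len by (intro bij_betw_nth) (auto simp: xs_def[symmetric] lessThan_Suc_atMost)
  have pos: "pos w \<le> l" "xs ! pos w = w" if "w \<in> carrier G" for w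
    using that bij the_inv_into_into[of "(!) xs" "{..l}" w "{..l}"]
      f_the_inv_into_f_bij_betw[OF bij, of w]
    by (auto simp: pos_def bij_betw_def)
  have pos_nth: "pos (xs ! i) = i" if "i \<le> l" for i
    using that bij unfolding pos_def bij_betw_def by (intro the_inv_into_f_f) auto
  define t where "t = xs ! l"
  define f where "f w = xs ! Suc (pos w)" for w
  have t: "t \<in> carrier G" using bij_betwE[OF bij] by (simp add: t_def)
  have lt: "pos w < l" if "w \<in> carrier G - {t}" for w
  proof -
    have "pos w \<noteq> l" using pos(2)[of w] that unfolding t_def by fastforce
    then show ?thesis using pos(1)[of w] that by simp
  qed
  have pos_f: "pos (f w) = Suc (pos w)" if "w \<in> carrier G - {t}" for w
    using lt[OF that] by (simp add: f_def pos_nth)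
  show ?thesis
  proof (rule that[OF t])
    show "inj_on f (carrier G - {t})"
    proof (rule inj_onI)
      fix w w' assume w: "w \<in> carrier G - {t}" "w' \<in> carrier G - {t}" "f w = f w'"
      then have "Suc (pos w) = Suc (pos w')" using pos_f by metis
      then have "xs ! pos w = xs ! pos w'" by simp
      moreover have "xs ! pos w = w" "xs ! pos w' = w'" using w(1,2) by (auto intro: pos)
      ultimately show "w = w'" by argo
    qed
    show "\<exists>s\<in>S. f w = w \<otimes>\<^bsub>G\<^esub> s" if "w \<in> carrier G - {t}" for w
      using adj[OF lt[OF that]] pos(2)[of w] that unfolding f_def by auto
    fix C assume C: "C \<subseteq> carrier G - {t}" "f ` C \<subseteq> C"
    show "C = {}"
    proof (rule ccontr)
      assume "C \<noteq> {}"
      have fin: "finite (pos ` C)"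
        by (rule finite_subset[of _ "{..l}"]) (use C(1) pos(1) in auto)
      then have "Max (pos ` C) \<in> pos ` C" using \<open>C \<noteq> {}\<close> by (intro Max_in) auto
      then obtain w where w: "w \<in> C" "pos w = Max (pos ` C)" by auto
      then have "pos (f w) \<le> Max (pos ` C)" using C(2) by (intro Max_ge[OF fin]) blast
      moreover have "pos (f w) = Suc (pos w)" using w(1) C(1) by (intro pos_f) auto
      ultimately show False using w(2) by simp
    qed
  qed
qed

section \<open>A semidirect product defined by a primitive root\<close>

lemma cyclic_integer_mod_group: "cyclic_group (integer_mod_group n)"
proof -
  have "1 mod int n \<in> carrier (integer_mod_group n)"
    by (auto simp: carrier_integer_mod_group)
  moreover have "carrier (integer_mod_group n) =
      range (\<lambda>k::int. (1 mod int n) [^]\<^bsub>integer_mod_group n\<^esub> k)"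
  proof (intro equalityI subsetI)
    fix x assume "x \<in> carrier (integer_mod_group n)"
    then have "x = (1 mod int n) [^]\<^bsub>integer_mod_group n\<^esub> x"
      by (auto simp: carrier_integer_mod_group int_pow_integer_mod_group mod_simps split: if_splits)
    then show "x \<in> range (\<lambda>k::int. (1 mod int n) [^]\<^bsub>integer_mod_group n\<^esub> k)" by blast
  qed (auto simp: carrier_integer_mod_group int_pow_integer_mod_group)
  ultimately show ?thesis
    using group.cyclic_group[OF group_integer_mod_group] by blast
qed

text \<open>The generator \<open>1\<close> of \<open>\<int>\<^sub>m\<close> acts on \<open>\<int>\<^sub>p\<close> as multiplication by a primitive root \<open>g\<close>, which
  is well defined because \<open>m\<close> is a multiple of \<open>p - 1\<close>. The factor \<open>n + 1\<close> in \<open>m\<close> makes the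
  orders of the generators large. The first coordinate \<open>2 * j + 1\<close> of \<open>a\<close> is \<open>(p - 1) / 2\<close>, so
  \<open>a\<close> acts by \<open>-1\<close>; that of \<open>b\<close> is smaller by one, and the second coordinates are chosen
  such that \<open>a = (1, 0) b\<close>.\<close>

locale primroot_extension =
  fixes p g n j :: nat
  assumes prime_p: "Factorial_Ring.prime p"
    and p_eq: "p = 4 * j + 3" and j_pos: "j > 0"
    and primroot: "residue_primroot p g"
begin

definition m :: nat where "m = (p - 1) * (n + 1)"

text \<open>This is the character of \<open>\<int>\<^sub>m\<close> by which it acts, with values read modulo \<open>p\<close>.\<close>

definition \<chi> :: "int \<Rightarrow> int" where "\<chi> k = int g ^ nat k"

text \<open>The restriction to the carrier is due to \<^const>\<open>AutoGroup\<close>, whose elements are extensional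
  functions.\<close>

definition \<phi> :: "int \<Rightarrow> int \<Rightarrow> int" where
  "\<phi> k = (\<lambda>x\<in>carrier (integer_mod_group p). \<chi> k * x mod int p)"

definition \<Gamma> :: "(int \<times> int) monoid" where
  "\<Gamma> = semidirect_product (integer_mod_group m) (integer_mod_group p) \<phi>"

definition a :: "int \<times> int" where "a = (2 * int j + 1, int g mod int p)"

definition b :: "int \<times> int" where "b = (2 * int j, 1)"

lemma int_p: "int p = 4 * int j + 3"
  by (simp add: p_eq)

lemma p_gt: "int p > 1" "p > 1"
  by (simp_all add: p_eq)

lemma int_m: "int m = (4 * int j + 2) * (int n + 1)"
proof -
  have "p - 1 = 4 * j + 2" by (simp add: p_eq)
  then show ?thesis by (simp add: m_def algebra_simps)
qed

lemma m_gt: "int m > 2 * int j + 1" "m > 0"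
proof -
  have "(4 * int j + 2) * 1 \<le> int m"
    unfolding int_m by (intro mult_left_mono) auto
  then have "int m \<ge> 4 * int j + 2" by simp
  then show "int m > 2 * int j + 1" "m > 0" by linarith+
qed

lemma even_m: "even (int m)"
  by (simp add: int_m)

lemma p_minus_1_dvd_m: "int p - 1 dvd int m"
  unfolding int_m int_p by (rule dvdI[of _ _ "int n + 1"]) simp

lemma prime_int_p: "Factorial_Ring.prime (int p)"
  using prime_p by simp

lemma carrier_Zp: "carrier (integer_mod_group p) = {0..<int p}"
  and carrier_Zm: "carrier (integer_mod_group m) = {0..<int m}"
  using p_gt m_gt by (auto simp: carrier_integer_mod_group)

subsection \<open>Powers of the primitive root\<close>

lemma chi_0 [simp]: "\<chi> 0 = 1"
  by (simp add: \<chi>_def)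

lemma chi_1 [simp]: "\<chi> 1 = int g"
  by (simp add: \<chi>_def)

lemma chi_add: "0 \<le> k \<Longrightarrow> 0 \<le> l \<Longrightarrow> \<chi> (k + l) = \<chi> k * \<chi> l"
  by (simp add: \<chi>_def nat_add_distrib power_add)

lemma coprime_chi: "coprime (\<chi> k) (int p)"
  using primroot by (simp add: \<chi>_def residue_primroot_def coprime_commute)

lemma chi_cong_iff:
  assumes "0 \<le> k" "0 \<le> l"
  shows "[\<chi> k = \<chi> l] (mod int p) \<longleftrightarrow> [k = l] (mod int p - 1)"
proof -
  have g: "coprime p g" "Pocklington.ord p g = p - 1"
    using primroot prime_p by (auto simp: residue_primroot_def totient_prime)
  have "[\<chi> k = \<chi> l] (mod int p) \<longleftrightarrow> [g ^ nat k = g ^ nat l] (mod p)"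
    by (simp add: \<chi>_def flip: cong_int_iff)
  also have "\<dots> \<longleftrightarrow> [nat k = nat l] (mod p - 1)"
    using order_divides_expdiff[OF g(1)] g(2) by simp
  also have "\<dots> \<longleftrightarrow> [k = l] (mod int p - 1)"
    using assms p_gt by (simp add: of_nat_diff flip: cong_int_iff)
  finally show ?thesis .
qed

lemma chi_cong_mod_m:
  assumes "0 \<le> k" "0 \<le> l" "[k = l] (mod int m)"
  shows "[\<chi> k = \<chi> l] (mod int p)"
  using assms p_minus_1_dvd_m by (simp add: chi_cong_iff cong_dvd_modulus)

lemma chi_mod: "0 \<le> k \<Longrightarrow> [\<chi> (k mod int m) = \<chi> k] (mod int p)"
  using m_gt by (intro chi_cong_mod_m) auto

lemma chi_surj:
  assumes "\<not> int p dvd y"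
  obtains k where "k \<in> {0..<int m}" "[\<chi> k = y] (mod int p)"
proof -
  have p1: "p > 1" using p_gt by simp
  have "y mod int p \<noteq> 0" using assms by (simp add: dvd_eq_mod_eq_0)
  moreover have "0 \<le> y mod int p" "y mod int p < int p" using p1 by auto
  ultimately have "nat (y mod int p) \<in> totatives p"
    using prime_p by (simp add: totatives_prime nat_less_iff)
  moreover have "totatives p = (\<lambda>i. g ^ i mod p) ` {..<p - 1}"
    using residue_primroot_is_generator[OF p1 primroot]
    by (simp add: bij_betw_def totient_prime[OF prime_p])
  ultimately obtain i where i: "i < p - 1" "g ^ i mod p = nat (y mod int p)"
    by (auto simp: image_def)
  have "int (g ^ i mod p) = y mod int p" using i p1 by simp
  then have "[\<chi> (int i) = y] (mod int p)" by (simp add: \<chi>_def cong_def zmod_int)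
  have "p - 1 \<le> m" using mult_le_mono2[of 1 "n + 1" "p - 1"] by (simp add: m_def)
  then have "int i \<in> {0..<int m}" using i by simp
  then show ?thesis by (rule that) fact
qed

text \<open>The square of \<open>\<chi> ((p - 1) / 2)\<close> is \<open>1\<close>, but \<open>\<chi> ((p - 1) / 2)\<close> itself is not, as \<open>g\<close> has
  order \<open>p - 1\<close>.\<close>

lemma chi_half: "[\<chi> (2 * int j + 1) = -1] (mod int p)"
proof -
  let ?c = "\<chi> (2 * int j + 1)"
  have "[\<chi> ((2 * int j + 1) + (2 * int j + 1)) = \<chi> 0] (mod int p)"
    by (subst chi_cong_iff) (auto simp: int_p cong_0_iff add.commute)
  then have "int p dvd (?c - 1) * (?c + 1)"
    by (subst (asm) chi_add) (auto simp: cong_iff_dvd_diff algebra_simps)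
  moreover have "\<not> int p dvd ?c - 1"
  proof
    assume "int p dvd ?c - 1"
    then have "[\<chi> (2 * int j + 1) = \<chi> 0] (mod int p)" by (simp add: cong_iff_dvd_diff)
    then have "int p - 1 dvd 2 * int j + 1" by (subst (asm) chi_cong_iff) (auto simp: cong_0_iff)
    then show False using zdvd_imp_le[of "int p - 1" "2 * int j + 1"] int_p by linarith
  qed
  ultimately have "int p dvd ?c + 1" using prime_dvd_multD[OF prime_int_p] by blast
  then show ?thesis by (simp add: cong_iff_dvd_diff)
qed

lemma coprime_chi_minus_1:
  assumes "0 < k" "k < int p - 1"
  shows "coprime (\<chi> k - 1) (int p)"
proof -
  have "\<not> int p dvd \<chi> k - 1"
  proof
    assume "int p dvd \<chi> k - 1"
    then have "[\<chi> k = \<chi> 0] (mod int p)" by (simp add: cong_iff_dvd_diff)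
    then have "int p - 1 dvd k" using assms by (subst (asm) chi_cong_iff) (auto simp: cong_0_iff)
    then show False using zdvd_imp_le[of "int p - 1" k] assms by linarith
  qed
  then show ?thesis using prime_imp_coprime[OF prime_int_p] coprime_commute by blast
qed

subsection \<open>The group\<close>

lemma phi_apply: "x \<in> {0..<int p} \<Longrightarrow> \<phi> k x = \<chi> k * x mod int p"
  by (simp add: \<phi>_def carrier_Zp)

lemma phi_in_Bij: "\<phi> k \<in> Bij {0..<int p}"
proof -
  have p0: "int p > 0" using p_gt by simp
  have inj: "inj_on (\<phi> k) {0..<int p}"
  proof (rule inj_onI)
    fix x y assume xy: "x \<in> {0..<int p}" "y \<in> {0..<int p}" "\<phi> k x = \<phi> k y"
    then have "[\<chi> k * x = \<chi> k * y] (mod int p)" by (simp add: phi_apply cong_def)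
    then have "[x = y] (mod int p)" using coprime_chi by (simp add: cong_mult_lcancel)
    then show "x = y" using xy by (auto intro: cong_less_imp_eq_int)
  qed
  have into: "\<phi> k ` {0..<int p} \<subseteq> {0..<int p}" using p0 by (auto simp: phi_apply)
  have "\<phi> k ` {0..<int p} = {0..<int p}"
    by (rule endo_inj_surj) (use inj into in auto)
  then show ?thesis
    using inj by (simp add: Bij_def bij_betw_def \<phi>_def carrier_Zp)
qed

lemma phi_hom: "\<phi> \<in> hom (integer_mod_group m) (AutoGroup (integer_mod_group p))"
proof (rule homI)
  fix k assume "k \<in> carrier (integer_mod_group m)"
  have "\<phi> k \<in> hom (integer_mod_group p) (integer_mod_group p)"
    using p_gt by (intro homI) (auto simp: carrier_Zp phi_apply mod_simps distrib_left)
  then show "\<phi> k \<in> carrier (AutoGroup (integer_mod_group p))"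
    using phi_in_Bij by (simp add: AutoGroup_def auto_def carrier_Zp)
next
  fix k l assume kl: "k \<in> carrier (integer_mod_group m)" "l \<in> carrier (integer_mod_group m)"
  have p0: "int p > 0" using p_gt by simp
  have "\<phi> ((k + l) mod int m) x = compose {0..<int p} (\<phi> k) (\<phi> l) x" for x
  proof (cases "x \<in> {0..<int p}")
    case True
    have "[\<chi> ((k + l) mod int m) = \<chi> k * \<chi> l] (mod int p)"
      using chi_mod[of "k + l"] chi_add[of k l] kl by (simp add: carrier_Zm)
    then have "[\<chi> ((k + l) mod int m) * x = \<chi> k * \<chi> l * x] (mod int p)"
      by (rule cong_scalar_right)
    then show ?thesis
      using True p0 by (simp add: phi_apply compose_def cong_def mod_simps mult.assoc)
  next
    case False
    then show ?thesis using phi_in_Bij by (auto simp: Bij_def extensional_def compose_def)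
  qed
  then show "\<phi> (k \<otimes>\<^bsub>integer_mod_group m\<^esub> l) =
      \<phi> k \<otimes>\<^bsub>AutoGroup (integer_mod_group p)\<^esub> \<phi> l"
    using phi_in_Bij by (simp add: AutoGroup_def BijGroup_def carrier_Zp fun_eq_iff)
qed

sublocale G: group \<Gamma>
  unfolding \<Gamma>_def by (intro group_semidirect_product phi_hom) auto

lemma carrier_G: "carrier \<Gamma> = {0..<int m} \<times> {0..<int p}"
  by (simp add: \<Gamma>_def semidirect_product_def carrier_Zm carrier_Zp)

lemma one_G: "\<one>\<^bsub>\<Gamma>\<^esub> = (0, 0)"
  by (simp add: \<Gamma>_def semidirect_product_def)

lemma mult_G:
  assumes "y \<in> {0..<int p}"
  shows "(h, x) \<otimes>\<^bsub>\<Gamma>\<^esub> (k, y) = ((h + k) mod int m, (x + \<chi> h * y) mod int p)"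
  using assms by (simp add: \<Gamma>_def semidirect_product_def phi_apply mod_simps)

lemma finite_G: "finite (carrier \<Gamma>)"
  by (simp add: carrier_G)

lemma ab_in_G: "a \<in> carrier \<Gamma>" "b \<in> carrier \<Gamma>"
  using m_gt p_gt by (auto simp: a_def b_def carrier_G)

lemma mult_a:
  assumes "0 \<le> h"
  shows "(h, x) \<otimes>\<^bsub>\<Gamma>\<^esub> a = ((h + 2 * int j + 1) mod int m, (x + \<chi> (h + 1)) mod int p)"
proof -
  have "[x + \<chi> h * (int g mod int p) = x + \<chi> h * int g] (mod int p)"
    by (intro cong_add cong_mult) (auto simp: cong_def)
  then show ?thesis using assms p_gt by (simp add: a_def mult_G chi_add add.assoc cong_def)
qed

lemma mult_b: "(h, x) \<otimes>\<^bsub>\<Gamma>\<^esub> b = ((h + 2 * int j) mod int m, (x + \<chi> h) mod int p)"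
  using p_gt by (simp add: b_def mult_G)

sublocale fst: group_hom \<Gamma> "integer_mod_group m" fst
proof (intro group_hom.intro group_hom_axioms.intro)
  show "fst \<in> hom \<Gamma> (integer_mod_group m)"
    by (rule homI) (auto simp: \<Gamma>_def semidirect_product_def carrier_Zm)
qed (simp_all add: G.is_group)

lemma kernel_fst: "kernel \<Gamma> (integer_mod_group m) fst = {0} \<times> {0..<int p}"
  using m_gt by (auto simp: kernel_def carrier_G)

lemma N_normal: "{0} \<times> {0..<int p} \<lhd> \<Gamma>"
  using fst.normal_kernel by (simp add: kernel_fst)

text \<open>In \<open>\<int>\<^sub>m\<close> the order of a small positive \<open>k\<close> is at least \<open>m / k\<close>.\<close>

lemma ord_gt:
  assumes x: "x \<in> carrier \<Gamma>" and k: "fst x = k" "0 < k" "k < 4 * int j + 2"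
  shows "G.ord x > n"
proof -
  let ?d = "G.ord x"
  have d: "?d > 0" using G.ord_ge_1[OF finite_G x] by simp
  have "fst (x [^]\<^bsub>\<Gamma>\<^esub> ?d) = 0" using x by (simp add: one_G)
  moreover have "fst (x [^]\<^bsub>\<Gamma>\<^esub> ?d) = int ?d * k mod int m"
    using fst.hom_nat_pow[OF x, of ?d] k by simp
  ultimately have "int m dvd int ?d * k" by (simp add: dvd_eq_mod_eq_0)
  then have "int m \<le> int ?d * k" using d k by (intro zdvd_imp_le) auto
  also have "\<dots> < int ?d * (4 * int j + 2)" using d k by simp
  finally have "int n + 1 < int ?d"
    unfolding int_m using mult_less_cancel_left[of "4 * int j + 2"] by (simp add: mult.commute)
  then show ?thesis by simp
qed

text \<open>The generated subgroup contains \<open>a b\<inverse> = (1, 0)\<close>, hence all \<open>(k, 0)\<close>. The products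
  \<open>(k, 0) b (l, 0)\<close> are the remaining elements, because \<open>\<chi>\<close> takes every nonzero value.\<close>

lemma generate_ab: "generate \<Gamma> {a, b} = carrier \<Gamma>"
proof
  let ?H = "generate \<Gamma> {a, b}"
  have sub: "subgroup ?H \<Gamma>" using ab_in_G by (intro G.generate_is_subgroup) auto
  interpret H: subgroup ?H \<Gamma> by (rule sub)
  show "?H \<subseteq> carrier \<Gamma>" by (rule H.subset)
  have ab: "a \<in> ?H" "b \<in> ?H" by (auto intro: generate.incl)
  have p0: "0 < int p" "0 \<in> {0..<int p}" using p_gt by auto
  have c_in: "(1, 0) \<in> carrier \<Gamma>" using m_gt p0 j_pos by (auto simp: carrier_G)
  have "(1, 0) \<otimes>\<^bsub>\<Gamma>\<^esub> b = a" using m_gt j_pos by (simp add: mult_b a_def)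
  then have "(1, 0) = a \<otimes>\<^bsub>\<Gamma>\<^esub> inv\<^bsub>\<Gamma>\<^esub> b"
    using G.inv_solve_right c_in ab_in_G by metis
  then have c: "(1, 0) \<in> ?H" using ab by (metis H.m_closed H.m_inv_closed)
  have H0: "(int k mod int m, 0) \<in> ?H" for k
  proof (induction k)
    case 0
    then show ?case using H.one_closed by (simp add: one_G)
  next
    case (Suc k)
    then have "(int k mod int m, 0) \<otimes>\<^bsub>\<Gamma>\<^esub> (1, 0) \<in> ?H" using c by (rule H.m_closed)
    then show ?case using p0 by (simp add: mult_G mod_simps add.commute)
  qed
  have H0': "(k, 0) \<in> ?H" if "k \<in> {0..<int m}" for k
    using H0[of "nat k"] that by simp
  show "carrier \<Gamma> \<subseteq> ?H"
  proof
    fix v assume "v \<in> carrier \<Gamma>"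
    then obtain h x where v: "v = (h, x)" "h \<in> {0..<int m}" "x \<in> {0..<int p}"
      by (auto simp: carrier_G)
    show "v \<in> ?H"
    proof (cases "x = 0")
      case True
      then show ?thesis using H0' v by simp
    next
      case False
      then have "\<not> int p dvd x" using v zdvd_not_zless by auto
      then obtain k where k: "k \<in> {0..<int m}" "[\<chi> k = x] (mod int p)"
        using chi_surj by blast
      let ?l = "(h - (k + 2 * int j)) mod int m"
      have "(k, 0) \<otimes>\<^bsub>\<Gamma>\<^esub> b \<otimes>\<^bsub>\<Gamma>\<^esub> (?l, 0) = v"
        using k v p0 by (simp add: mult_b mult_G cong_def mod_simps)
      moreover have "(k, 0) \<otimes>\<^bsub>\<Gamma>\<^esub> b \<otimes>\<^bsub>\<Gamma>\<^esub> (?l, 0) \<in> ?H"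
        using k(1) m_gt by (intro H.m_closed ab H0') auto
      ultimately show ?thesis by (simp only:)
    qed
  qed
qed

text \<open>The quotient by \<open>{0} \<times> \<int>\<^sub>p\<close> is abelian. Conversely, the commutator of \<open>(1, 0)\<close> and \<open>(0, w)\<close>
  is \<open>(0, (g - 1) * w)\<close>, where \<open>g - 1\<close> is invertible modulo \<open>p\<close>.\<close>

lemma derived_G: "derived \<Gamma> (carrier \<Gamma>) = {0} \<times> {0..<int p}"
proof
  let ?N = "{0} \<times> {0..<int p}"
  have N: "subgroup ?N \<Gamma>" using N_normal by (rule normal_imp_subgroup)
  have "derived_set \<Gamma> (carrier \<Gamma>) \<subseteq> ?N"
  proof
    fix z assume "z \<in> derived_set \<Gamma> (carrier \<Gamma>)"
    then obtain x y where xy: "x \<in> carrier \<Gamma>" "y \<in> carrier \<Gamma>"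
      "z = x \<otimes>\<^bsub>\<Gamma>\<^esub> y \<otimes>\<^bsub>\<Gamma>\<^esub> inv\<^bsub>\<Gamma>\<^esub> x \<otimes>\<^bsub>\<Gamma>\<^esub> inv\<^bsub>\<Gamma>\<^esub> y" by blast
    have "fst x \<in> carrier (integer_mod_group m)" "fst y \<in> carrier (integer_mod_group m)"
      using xy by (auto simp: carrier_G carrier_Zm)
    then have "fst z = 0" using xy by (simp add: mod_simps)
    then have "z \<in> kernel \<Gamma> (integer_mod_group m) fst" using xy by (simp add: kernel_def)
    then show "z \<in> ?N" by (simp add: kernel_fst)
  qed
  then show "derived \<Gamma> (carrier \<Gamma>) \<subseteq> ?N"
    unfolding derived_def using N by (rule G.generate_subgroup_incl)
  show "?N \<subseteq> derived \<Gamma> (carrier \<Gamma>)"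
  proof
    fix z :: "int \<times> int" assume "z \<in> ?N"
    then obtain y where z: "z = (0, y)" "y \<in> {0..<int p}" by auto
    have p0: "0 < int p" "0 \<in> {0..<int p}" using p_gt by auto
    have "coprime (\<chi> 1 - 1) (int p)" using j_pos by (intro coprime_chi_minus_1) (auto simp: int_p)
    then obtain i where i: "[(int g - 1) * i = 1] (mod int p)"
      using cong_solve_coprime_int by auto
    define w where "w = i * y mod int p"
    have w: "w \<in> {0..<int p}" using p0 by (simp add: w_def)
    have "[(int g - 1) * w = (int g - 1) * i * y] (mod int p)"
      by (simp add: w_def cong_def mod_simps mult.assoc)
    also have "[(int g - 1) * i * y = 1 * y] (mod int p)" using i by (rule cong_scalar_right)
    finally have "[(int g - 1) * w + w = y + w] (mod int p)" by (simp add: cong_add_rcancel)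
    then have gw: "(y + w) mod int p = int g * w mod int p"
      by (simp add: algebra_simps cong_def)
    let ?c = "(1, 0) :: int \<times> int" and ?w = "(0, w) :: int \<times> int"
    have in_G: "?c \<in> carrier \<Gamma>" "?w \<in> carrier \<Gamma>" "z \<in> carrier \<Gamma>"
      using m_gt p0 w z j_pos by (auto simp: carrier_G)
    have "z \<otimes>\<^bsub>\<Gamma>\<^esub> ?w \<otimes>\<^bsub>\<Gamma>\<^esub> ?c = ?c \<otimes>\<^bsub>\<Gamma>\<^esub> ?w"
      using z w p0 gw by (simp add: mult_G)
    then have "z = ?c \<otimes>\<^bsub>\<Gamma>\<^esub> ?w \<otimes>\<^bsub>\<Gamma>\<^esub> inv\<^bsub>\<Gamma>\<^esub> ?c \<otimes>\<^bsub>\<Gamma>\<^esub> inv\<^bsub>\<Gamma>\<^esub> ?w"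
      using in_G by (metis G.inv_solve_right G.m_closed G.inv_closed)
    then have "z \<in> derived_set \<Gamma> (carrier \<Gamma>)" using in_G by blast
    then show "z \<in> derived \<Gamma> (carrier \<Gamma>)" unfolding derived_def by (rule generate.incl)
  qed
qed

lemma metacyclic_G: "metacyclic_group \<Gamma>"
  unfolding metacyclic_group_def
proof (intro exI conjI)
  let ?N = "{0} \<times> {0..<int p}"
  show "?N \<lhd> \<Gamma>" by (rule N_normal)
  have N: "subgroup ?N \<Gamma>" using N_normal by (rule normal_imp_subgroup)
  have p0: "0 < int p" using p_gt by simp
  have "(\<lambda>y. (0, y)) \<in> epi (integer_mod_group p) (subgroup_generated \<Gamma> ?N)"
    unfolding epi_def
  proof (intro CollectI conjI)
    show "(\<lambda>y. (0, y)) \<in> hom (integer_mod_group p) (subgroup_generated \<Gamma> ?N)"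
      using p0 by (intro homI)
        (auto simp: subgroup.carrier_subgroup_generated_subgroup[OF N] carrier_Zp mult_G)
    show "(\<lambda>y. (0, y)) ` carrier (integer_mod_group p) = carrier (subgroup_generated \<Gamma> ?N)"
      by (auto simp: subgroup.carrier_subgroup_generated_subgroup[OF N] carrier_Zp)
  qed
  then show "cyclic_group (subgroup_generated \<Gamma> ?N)"
    by (rule group.cyclic_group_epimorphic_image[rotated])
      (auto simp: cyclic_integer_mod_group G.group_subgroup_generated)
  have "fst ` carrier \<Gamma> = carrier (integer_mod_group m)"
    using p0 by (auto simp: carrier_G carrier_Zm image_iff)
  then have "\<Gamma> Mod ?N \<cong> integer_mod_group m"
    using fst.FactGroup_iso by (simp add: kernel_fst)
  then show "cyclic_group (\<Gamma> Mod ?N)"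
    using isomorphic_group_cyclicity normal.factorgroup_is_group[OF N_normal]
      cyclic_integer_mod_group by force
qed

end

section \<open>Columns along a hamiltonian path\<close>

text \<open>A hamiltonian path that ends at \<open>(h0, x0)\<close> is represented by its successor map \<open>f\<close>. The
  column of \<open>x\<close> is the set of all vertices \<open>(h, x)\<close>; it is a left coset of the subgroup generated
  by \<open>(1, 0)\<close>, which is \<open>a b\<inverse>\<close>. The assumptions are contradictory, since the path would have
  to be caught in a cycle.\<close>

locale hamiltonian_successor = primroot_extension +
  fixes h0 x0 :: int and f :: "int \<times> int \<Rightarrow> int \<times> int"
  assumes end_in_G: "(h0, x0) \<in> carrier \<Gamma>"
    and inj_f: "inj_on f (carrier \<Gamma> - {(h0, x0)})"
    and f_cases: "v \<in> carrier \<Gamma> - {(h0, x0)} \<Longrightarrow> f v = v \<otimes>\<^bsub>\<Gamma>\<^esub> a \<or> f v = v \<otimes>\<^bsub>\<Gamma>\<^esub> b"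
    and no_closed_set: "C \<subseteq> carrier \<Gamma> - {(h0, x0)} \<Longrightarrow> f ` C \<subseteq> C \<Longrightarrow> C = {}"
begin

lemma not_end:
  "h \<in> {0..<int m} \<Longrightarrow> x \<in> {0..<int p} \<Longrightarrow> x \<noteq> x0 \<Longrightarrow> (h, x) \<in> carrier \<Gamma> - {(h0, x0)}"
  by (simp add: carrier_G)

definition a_column :: "int \<Rightarrow> bool" where
  "a_column x \<longleftrightarrow> (\<forall>h\<in>{0..<int m}. f (h, x) = (h, x) \<otimes>\<^bsub>\<Gamma>\<^esub> a)"

text \<open>Since \<open>(h, x) a = (h + 1, x) b\<close>, injectivity of \<open>f\<close> forbids the path to leave \<open>(h, x)\<close> by
  \<open>a\<close> and \<open>(h + 1, x)\<close> by \<open>b\<close>.\<close>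

lemma a_step_Suc:
  assumes h: "h \<in> {0..<int m}" and x: "x \<in> {0..<int p}" "x \<noteq> x0"
    and fa: "f (h, x) = (h, x) \<otimes>\<^bsub>\<Gamma>\<^esub> a"
  shows "f ((h + 1) mod int m, x) = ((h + 1) mod int m, x) \<otimes>\<^bsub>\<Gamma>\<^esub> a"
proof -
  let ?w = "((h + 1) mod int m, x)"
  have w: "?w \<in> carrier \<Gamma> - {(h0, x0)}" using m_gt x by (intro not_end) auto
  have "[x + \<chi> ((h + 1) mod int m) = x + \<chi> (h + 1)] (mod int p)"
    using chi_mod[of "h + 1"] h by (intro cong_add) auto
  then have "?w \<otimes>\<^bsub>\<Gamma>\<^esub> b = f (h, x)"
    using h by (simp add: fa mult_a mult_b cong_def mod_simps ac_simps)
  then show ?thesis using f_cases[OF w] inj_onD[OF inj_f _ w not_end[OF h x]] fa by fastforce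
qed

lemma a_columnI:
  assumes h: "h \<in> {0..<int m}" and x: "x \<in> {0..<int p}" "x \<noteq> x0"
    and fa: "f (h, x) = (h, x) \<otimes>\<^bsub>\<Gamma>\<^esub> a"
  shows "a_column x"
proof -
  have "f ((h + int k) mod int m, x) = ((h + int k) mod int m, x) \<otimes>\<^bsub>\<Gamma>\<^esub> a" for k
  proof (induction k)
    case 0
    then show ?case using fa h by simp
  next
    case (Suc k)
    then show ?case using a_step_Suc[of "(h + int k) mod int m" x] x m_gt
      by (simp add: mod_simps ac_simps)
  qed
  from this[of "nat ((h' - h) mod int m)" for h']
  have "f (h' mod int m, x) = (h' mod int m, x) \<otimes>\<^bsub>\<Gamma>\<^esub> a" for h'
    using m_gt by (simp add: mod_simps)
  then show ?thesis unfolding a_column_def by (metis atLeastLessThan_iff mod_pos_pos_trivial)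
qed

lemma b_step:
  assumes "h \<in> {0..<int m}" "x \<in> {0..<int p}" "x \<noteq> x0" "\<not> a_column x"
  shows "f (h, x) = (h, x) \<otimes>\<^bsub>\<Gamma>\<^esub> b"
  using f_cases[OF not_end[OF assms(1-3)]] a_columnI assms by blast

text \<open>The first coordinate of \<open>a\<close> acts on \<open>\<int>\<^sub>p\<close> by \<open>-1\<close>, so a walk along \<open>a\<close> alternates between
  two columns, and a suitable starting height \<open>h\<close> makes these any two given columns. Two
  \<open>a\<close>-columns off the column of the end vertex would therefore trap the path in a cycle.\<close>

lemma a_column_unique:
  assumes x: "x \<in> {0..<int p}" "x \<noteq> x0" "a_column x"
    and y: "y \<in> {0..<int p}" "y \<noteq> x0" "a_column y"
  shows "x = y"
proof (rule ccontr)
  assume "x \<noteq> y"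
  \<comment> \<open>the vertices of either column from which \<open>a\<close> leads into the other one\<close>
  define C where "C = {(h, z). h \<in> {0..<int m} \<and>
    (z = x \<and> [\<chi> (h + 1) = y - x] (mod int p) \<or> z = y \<and> [\<chi> (h + 1) = x - y] (mod int p))}"
  have half: "f (h, u) \<in> C"
    if h: "h \<in> {0..<int m}" and uv: "(u, v) \<in> {(x, y), (y, x)}"
      and c: "[\<chi> (h + 1) = v - u] (mod int p)" for h u v
  proof -
    let ?h = "(h + 2 * int j + 1) mod int m"
    have "[u + \<chi> (h + 1) = u + (v - u)] (mod int p)" using c by (intro cong_add) auto
    then have "(u + \<chi> (h + 1)) mod int p = v" using uv x y by (auto simp: cong_def)
    then have fu: "f (h, u) = (?h, v)"
      using uv x y h by (auto simp: a_column_def mult_a)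
    have "[\<chi> (?h + 1) = \<chi> ((h + 1) + (2 * int j + 1))] (mod int p)"
      using h m_gt by (intro chi_cong_mod_m) (auto simp: cong_def mod_simps ac_simps)
    also have "\<chi> ((h + 1) + (2 * int j + 1)) = \<chi> (h + 1) * \<chi> (2 * int j + 1)"
      using h by (intro chi_add) auto
    also have "[\<dots> = (v - u) * -1] (mod int p)" using c chi_half by (rule cong_mult)
    finally have "[\<chi> (?h + 1) = u - v] (mod int p)" by simp
    then show ?thesis using uv m_gt by (auto simp: fu C_def)
  qed
  have "\<not> int p dvd y - x" using x y \<open>x \<noteq> y\<close>
    by (auto simp: mod_eq_dvd_iff[symmetric])
  then obtain k where k: "k \<in> {0..<int m}" "[\<chi> k = y - x] (mod int p)" using chi_surj by blast
  have "[\<chi> ((k - 1) mod int m + 1) = \<chi> k] (mod int p)"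
    using k m_gt by (intro chi_cong_mod_m) (auto simp: cong_def mod_simps)
  then have "((k - 1) mod int m, x) \<in> C"
    using k m_gt by (auto simp: C_def intro: cong_trans)
  moreover have "f ` C \<subseteq> C"
  proof (rule image_subsetI)
    fix v assume "v \<in> C"
    then obtain h u w where "v = (h, u)" "h \<in> {0..<int m}"
      "(u, w) \<in> {(x, y), (y, x)}" "[\<chi> (h + 1) = w - u] (mod int p)"
      unfolding C_def by blast
    then show "f v \<in> C" using half by simp
  qed
  moreover have "C \<subseteq> carrier \<Gamma> - {(h0, x0)}" using not_end x y by (auto simp: C_def)
  ultimately show False using no_closed_set by blast
qed

text \<open>Let \<open>q = \<chi> (2 * j)\<close> be the factor by which the first coordinate of \<open>b\<close> acts on \<open>\<int>\<^sub>p\<close>. A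
  walk along \<open>b\<close> moves \<open>x\<close> by \<open>\<chi> h\<close>, \<open>q * \<chi> h\<close>, \<open>q\<^sup>2 * \<chi> h\<close> and so on, hence stays on a circle
  with centre \<open>x - \<chi> h / (q - 1)\<close>. Centred at \<open>x0\<close> such a circle misses the column of the end
  vertex. The steps of \<open>b\<close> have even height, so there is one such circle for either parity of
  \<open>h\<close>; if it contained no \<open>a\<close>-column, then the path would be trapped in it.\<close>

lemma a_column_on_circle:
  assumes e: "e \<in> {0, 1 :: int}"
  obtains h x where "0 \<le> h" "even (h + e)" "x \<in> {0..<int p}" "x \<noteq> x0" "a_column x"
    "[\<chi> h = (\<chi> (2 * int j) - 1) * (x - x0)] (mod int p)"
proof (rule ccontr)
  assume "\<not> thesis"
  let ?q = "\<chi> (2 * int j) - 1"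
  have avoid: "\<not> a_column x" if "0 \<le> h" "even (h + e)" "x \<in> {0..<int p}" "x \<noteq> x0"
    "[\<chi> h = ?q * (x - x0)] (mod int p)" for h x
    using \<open>\<not> thesis\<close> that(1-5) \<open>\<And>h x. \<lbrakk>0 \<le> h; even (h + e); x \<in> {0..<int p}; x \<noteq> x0; a_column x;
      [\<chi> h = ?q * (x - x0)] (mod int p)\<rbrakk> \<Longrightarrow> thesis\<close> by blast
  define C where "C = {(h, z). h \<in> {0..<int m} \<and> z \<in> {0..<int p} \<and> even (h + e) \<and>
    [\<chi> h = ?q * (z - x0)] (mod int p)}"
  have z_ne: "z \<noteq> x0" if "(h, z) \<in> C" for h z
  proof
    assume "z = x0"
    then have "int p dvd \<chi> h" using that by (simp add: C_def cong_0_iff)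
    then show False
      using coprime_chi[of h] prime_int_p by (metis coprime_absorb_right not_prime_unit)
  qed
  have "f (h, z) \<in> C" if C: "(h, z) \<in> C" for h z
  proof -
    have hz: "h \<in> {0..<int m}" "z \<in> {0..<int p}" "even (h + e)"
      and c: "[\<chi> h = ?q * (z - x0)] (mod int p)" using C by (auto simp: C_def)
    have "\<not> a_column z" using avoid[of h z] hz c z_ne[OF C] by auto
    let ?h = "(h + 2 * int j) mod int m" and ?z = "(z + \<chi> h) mod int p"
    have fz: "f (h, z) = (?h, ?z)"
      using b_step[of h z] hz z_ne[OF C] \<open>\<not> a_column z\<close> by (simp add: mult_b)
    have "[\<chi> ?h = \<chi> (h + 2 * int j)] (mod int p)" using hz by (intro chi_mod) auto
    also have "\<chi> (h + 2 * int j) = \<chi> h + ?q * \<chi> h"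
      using hz by (simp add: chi_add algebra_simps)
    also have "[\<dots> = ?q * (z - x0) + ?q * \<chi> h] (mod int p)" using c by (intro cong_add) auto
    also have "?q * (z - x0) + ?q * \<chi> h = ?q * ((z + \<chi> h) - x0)" by (simp add: algebra_simps)
    also have "[\<dots> = ?q * (?z - x0)] (mod int p)"
      by (intro cong_mult cong_diff) (auto simp: cong_def)
    finally have "[\<chi> ?h = ?q * (?z - x0)] (mod int p)" .
    moreover have "even (?h + e)"
      using hz even_m by (simp add: dvd_mod_iff)
    ultimately show ?thesis using p_gt m_gt by (simp add: fz C_def)
  qed
  then have "f ` C \<subseteq> C" by (simp add: image_subset_iff split_paired_all)
  moreover have "C \<subseteq> carrier \<Gamma> - {(h0, x0)}"
  proof
    fix v assume "v \<in> C"
    moreover obtain h z where v: "v = (h, z)" by fastforce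
    ultimately show "v \<in> carrier \<Gamma> - {(h0, x0)}"
      using not_end[of h z] z_ne[of h z] by (simp add: C_def)
  qed
  ultimately have "C = {}" by (intro no_closed_set)
  have "coprime ?q (int p)" using j_pos by (intro coprime_chi_minus_1) (auto simp: int_p)
  then obtain i where i: "[?q * i = 1] (mod int p)" using cong_solve_coprime_int by blast
  let ?z = "(x0 + i * \<chi> e) mod int p"
  have "[?q * (?z - x0) = ?q * ((x0 + i * \<chi> e) - x0)] (mod int p)"
    by (intro cong_mult cong_diff) (auto simp: cong_def)
  also have "?q * ((x0 + i * \<chi> e) - x0) = ?q * i * \<chi> e" by simp
  also have "[\<dots> = 1 * \<chi> e] (mod int p)" using i by (rule cong_scalar_right)
  finally have "[\<chi> e = ?q * (?z - x0)] (mod int p)" by (simp add: cong_sym)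
  then have "(e, ?z) \<in> C" using e m_gt p_gt j_pos by (auto simp: C_def)
  with \<open>C = {}\<close> show False by simp
qed

text \<open>The circles for the two parities are disjoint, as \<open>\<chi> h\<close> determines \<open>h\<close> modulo the even
  number \<open>p - 1\<close>. They cannot both meet the only \<open>a\<close>-column.\<close>

lemma contradiction: False
proof -
  let ?q = "\<chi> (2 * int j) - 1"
  obtain h x where x: "0 \<le> h" "even (h + 0)" "x \<in> {0..<int p}" "x \<noteq> x0" "a_column x"
    "[\<chi> h = ?q * (x - x0)] (mod int p)"
    using a_column_on_circle[of 0] by blast
  obtain k y where y: "0 \<le> k" "even (k + 1)" "y \<in> {0..<int p}" "y \<noteq> x0" "a_column y"
    "[\<chi> k = ?q * (y - x0)] (mod int p)"
    using a_column_on_circle[of 1] by blast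
  have "x = y" using a_column_unique x y by blast
  then have "[\<chi> h = \<chi> k] (mod int p)" using x(6) y(6) by (auto intro: cong_trans cong_sym)
  then have "[h = k] (mod int p - 1)" using x y by (simp add: chi_cong_iff)
  then have "[h = k] (mod 2)" by (rule cong_dvd_modulus) (simp add: int_p)
  then show False using x(2) y(2) unfolding cong_def by presburger
qed

end

lemma (in primroot_extension) no_hamiltonian_path:
  "\<not> has_hamiltonian_path (cayley_digraph \<Gamma> {a, b})"
proof
  assume "has_hamiltonian_path (cayley_digraph \<Gamma> {a, b})"
  then obtain t f where t: "t \<in> carrier \<Gamma>" "inj_on f (carrier \<Gamma> - {t})"
    and f: "\<And>v. v \<in> carrier \<Gamma> - {t} \<Longrightarrow> \<exists>s\<in>{a, b}. f v = v \<otimes>\<^bsub>\<Gamma>\<^esub> s"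
    and closed: "\<And>C. C \<subseteq> carrier \<Gamma> - {t} \<Longrightarrow> f ` C \<subseteq> C \<Longrightarrow> C = {}"
    by (rule hamiltonian_path_successorE) blast
  obtain h0 x0 where t_eq: "t = (h0, x0)" by fastforce
  interpret hamiltonian_successor p g n j h0 x0 f
  proof unfold_locales
    show "C = {}" if "C \<subseteq> carrier \<Gamma> - {(h0, x0)}" "f ` C \<subseteq> C" for C
      using closed that unfolding t_eq .
  qed (use t f in \<open>auto simp: t_eq\<close>)
  show False by (rule contradiction)
qed

theorem theorem1p2:
  fixes n :: nat
  shows "(\<exists>(G :: (int \<times> int) monoid) a b.
            group G \<and> finite (carrier G) \<and> a \<in> carrier G \<and> b \<in> carrier G \<and>
            Digraph_Component.connected (cayley_digraph G {a, b}) \<and>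
            \<not> has_hamiltonian_path (cayley_digraph G {a, b}) \<and>
            group.ord G a > n \<and> group.ord G b > n) \<and>
         (\<forall>p :: nat. Factorial_Ring.prime p \<and> p > 3 \<and> [p = 3] (mod 4) \<longrightarrow>
            (\<exists>(G :: (int \<times> int) monoid) a b.
               group G \<and> finite (carrier G) \<and> a \<in> carrier G \<and> b \<in> carrier G \<and>
               Digraph_Component.connected (cayley_digraph G {a, b}) \<and>
               \<not> has_hamiltonian_path (cayley_digraph G {a, b}) \<and>
               group.ord G a > n \<and> group.ord G b > n \<and>
               card (derived G (carrier G)) = p \<and>
               (\<exists>(m :: nat) \<phi>. m > 0 \<and>
                  \<phi> \<in> hom (integer_mod_group m) (AutoGroup (integer_mod_group p)) \<and>
                  G = semidirect_product (integer_mod_group m) (integer_mod_group p) \<phi> \<and>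
                  {\<one>\<^bsub>integer_mod_group m\<^esub>} \<times> carrier (integer_mod_group p) \<lhd> G) \<and>
               metacyclic_group G))"
    (is "?A \<and> (\<forall>p :: nat. ?C p \<longrightarrow> ?E p)")
proof -
  have main: "?E p" if "?C p" for p
  proof -
    from that obtain g where g: "residue_primroot p g"
      using prime_primitive_root_exists[of p] prime_gt_1_nat by auto
    have "p = 4 * (p div 4) + 3"
      using that div_mult_mod_eq[of p 4] by (simp add: cong_def)
    moreover have "p div 4 > 0" using that by (simp add: div_greater_zero_iff)
    ultimately interpret primroot_extension p g n "p div 4"
      using that g by unfold_locales auto
    have "0 < m" using m_gt by simp
    moreover have "{\<one>\<^bsub>integer_mod_group m\<^esub>} \<times> carrier (integer_mod_group p) \<lhd> \<Gamma>"
      using N_normal by (simp add: carrier_Zp)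
    moreover have "card (derived \<Gamma> (carrier \<Gamma>)) = p"
      by (simp add: derived_G)
    moreover have "Digraph_Component.connected (cayley_digraph \<Gamma> {a, b})"
      using ab_in_G generate_ab by (intro G.generate_imp_connected_cayley_digraph) auto
    moreover have "G.ord a > n" "G.ord b > n"
      using ab_in_G j_pos by (auto intro!: ord_gt simp: a_def b_def)
    ultimately show ?thesis
      using G.is_group finite_G ab_in_G no_hamiltonian_path phi_hom metacyclic_G
      by (intro exI[of _ \<Gamma>] exI[of _ a] exI[of _ b] conjI exI[of _ m] exI[of _ \<phi>])
        (auto simp: \<Gamma>_def)
  qed
  have "?C 7" by (simp add: cong_def)
  then have "?E 7" by (rule main)
  then have ?A by (elim exE conjE) (intro exI conjI)
  then show ?thesis using main by blast
qed

end
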